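(* Let $q$ be a prime power, $m,k,h$ integers with $m,k\ge1$ and $0\le h<k$, and let $n=\lfloor\frac{km}{h+1}\rfloor$; assume $k<n$ and $$km-(h+2)\left\lfloor\frac{km}{h+1}\right\rfloor<0.$$ Let $\mathcal{U}$ be an $[n,k]_{q^m/q}$ system and $\mathcal{C}$ an $[n,k]_{q^m/q}$ code associated with $\mathcal{U}$. Then $\mathcal{U}$ is quasi-maximum $h$-scattered if and only if $\mathcal{C}^\perp$ is quasi-MRD.
   Context: An $[n,k]_{q^m/q}$ code is a $k$-dimensional $\mathbb{F}_{q^m}$-subspace of $\mathbb{F}_{q^m}^n$; the rank weight of a vector is the $\mathbb{F}_q$-dimension of the $\mathbb{F}_q$-span of its entries, and $d_{\mathrm{rk}}(\mathcal{C})$ is the least rank weight of a nonzero codeword. The dual is $\mathcal{C}^\perp=\{v: cv^\top=0\ \forall c\in\mathcal{C}\}$. An $[n,k]_{q^m/q}$ system is an $n$-dimensional $\mathbb{F}_q$-subspace $\mathcal{U}\subseteq\mathbb{F}_{q^m}^k$ with $\langle\mathcal{U}\rangle_{\mathbb{F}_{q^m}}=\mathbb{F}_{q^m}^k$. The codes associated with $\mathcal{U}$ are the codes $\{vA: v\in\mathcal{D}\}$, $A\in\mathrm{GL}(n,q)$, where $\mathcal{D}$ is the row space of the $k\times n$ matrix whose columns form an $\mathbb{F}_q$-basis of $\mathcal{U}$. $\mathcal{U}$ is $h$-scattered if $\dim_{\mathbb{F}_q}(\mathcal{U}\cap W)\le h$ for every $h$-dimensional $\mathbb{F}_{q^m}$-subspace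 $W$ of $\mathbb{F}_{q^m}^k$; it is quasi-maximum $h$-scattered if it is $h$-scattered and $\dim_{\mathbb{F}_q}\mathcal{U}=\lfloor\frac{km}{h+1}\rfloor$ (the paper uses this name when $h+1\nmid km$; when $h+1\mid km$ this is the notion of maximum $h$-scattered). The Singleton rank defect of an $[N,K,d]_{q^m/q}$ code $\mathcal{D}$ is $\mathrm{Rdef}(\mathcal{D})=m-\lceil\frac{Km}{N}\rceil-d+1$, and $\mathcal{D}$ is quasi-MRD if $\mathrm{Rdef}(\mathcal{D})=0$. *)

theory Defs
  imports "HOL-Analysis.Analysis"
begin

text \<open>
  The extension of \<open>F_q\<close> by \<open>F_(q^m)\<close> is given by finite fields \<open>'q\<close> and \<open>'f\<close> with
  \<open>CARD('f) = CARD('q) ^ m\<close> and an embedding \<open>\<iota> :: 'q \<Rightarrow> 'f\<close>. Notions over the large field on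
  \<open>'f ^ 'n\<close> are those of the library (\<open>vec.span\<close>, \<open>vec.dim\<close>, \<open>vec.subspace\<close>); notions over
  the small field are the generic ones, taken for the scalar multiplication restricted along \<open>\<iota>\<close>.
\<close>

definition field_embedding :: "('q::field \<Rightarrow> 'f::field) \<Rightarrow> bool" where
  "field_embedding \<iota> \<longleftrightarrow>
     \<iota> 1 = 1 \<and> (\<forall>a b. \<iota> (a + b) = \<iota> a + \<iota> b) \<and> (\<forall>a b. \<iota> (a * b) = \<iota> a * \<iota> b)"

definition scale_elem :: "('q \<Rightarrow> 'f::field) \<Rightarrow> 'q \<Rightarrow> 'f \<Rightarrow> 'f" where
  "scale_elem \<iota> c x = \<iota> c * x"

definition scale_vec :: "('q \<Rightarrow> 'f::field) \<Rightarrow> 'q \<Rightarrow> 'f ^ 'n \<Rightarrow> 'f ^ 'n" where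
  "scale_vec \<iota> c v = \<iota> c *s v"

lemma vector_space_scale_elem: "field_embedding \<iota> \<Longrightarrow> vector_space (scale_elem \<iota>)"
  by unfold_locales (simp_all add: field_embedding_def scale_elem_def algebra_simps)

lemma vector_space_scale_vec:
  "field_embedding \<iota> \<Longrightarrow> vector_space (scale_vec \<iota> :: 'q::field \<Rightarrow> 'f::field ^ 'n \<Rightarrow> _)"
  by unfold_locales
    (simp_all add: field_embedding_def scale_vec_def vec.scale_right_distrib vec.scale_left_distrib)

definition is_code :: "nat \<Rightarrow> nat \<Rightarrow> ('f::field ^ 'n) set \<Rightarrow> bool" where
  "is_code n k C \<longleftrightarrow> CARD('n) = n \<and> vec.subspace C \<and> vec.dim C = k"

definition rank_weight :: "('q::field \<Rightarrow> 'f::field) \<Rightarrow> 'f ^ 'n \<Rightarrow> nat" where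
  "rank_weight \<iota> v =
     vector_space.dim (scale_elem \<iota>) (module.span (scale_elem \<iota>) (range (($) v)))"

definition min_rank_distance :: "('q::field \<Rightarrow> 'f::field) \<Rightarrow> ('f ^ 'n) set \<Rightarrow> nat" where
  "min_rank_distance \<iota> C = (LEAST d. \<exists>c\<in>C. c \<noteq> 0 \<and> rank_weight \<iota> c = d)"

definition dual_code :: "('f::field ^ 'n) set \<Rightarrow> ('f ^ 'n) set" where
  "dual_code C = {v. \<forall>c\<in>C. scalar_product c v = 0}"

definition is_system ::
  "('q::field \<Rightarrow> 'f::field) \<Rightarrow> nat \<Rightarrow> nat \<Rightarrow> ('f ^ 'k) set \<Rightarrow> bool" where
  "is_system \<iota> n k U \<longleftrightarrow>
     CARD('k) = k \<and>
     module.subspace (scale_vec \<iota>) U \<and>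
     vector_space.dim (scale_vec \<iota>) U = n \<and>
     vec.span U = UNIV"

definition columns_form_basis ::
  "('q::field \<Rightarrow> 'f::field) \<Rightarrow> 'f ^ 'n ^ 'k \<Rightarrow> ('f ^ 'k) set \<Rightarrow> bool" where
  "columns_form_basis \<iota> G U \<longleftrightarrow>
     inj (\<lambda>j. column j G) \<and>
     \<not> module.dependent (scale_vec \<iota>) (columns G) \<and>
     module.span (scale_vec \<iota>) (columns G) = U"

definition associated_code ::
  "('q::field \<Rightarrow> 'f::field) \<Rightarrow> ('f ^ 'k) set \<Rightarrow> ('f ^ 'n) set \<Rightarrow> bool" where
  "associated_code \<iota> U C \<longleftrightarrow>
     (\<exists>(G :: 'f ^ 'n ^ 'k) (A :: 'q ^ 'n ^ 'n).
        columns_form_basis \<iota> G U \<and> invertible A \<and>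
        C = (\<lambda>v. v v* map_matrix \<iota> A) ` vec.span (rows G))"

definition scattered ::
  "('q::field \<Rightarrow> 'f::field) \<Rightarrow> nat \<Rightarrow> ('f ^ 'k) set \<Rightarrow> bool" where
  "scattered \<iota> h U \<longleftrightarrow>
     (\<forall>W. vec.subspace W \<and> vec.dim W = h \<longrightarrow>
        vector_space.dim (scale_vec \<iota>) (U \<inter> W) \<le> h)"

text \<open>If \<open>h + 1\<close> divides \<open>k m\<close>, this is the notion of a maximum \<open>h\<close>-scattered system.\<close>

definition quasi_maximum_scattered ::
  "('q::field \<Rightarrow> 'f::field) \<Rightarrow> nat \<Rightarrow> nat \<Rightarrow> ('f ^ 'k) set \<Rightarrow> bool" where
  "quasi_maximum_scattered \<iota> m h U \<longleftrightarrow>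
     scattered \<iota> h U \<and>
     int (vector_space.dim (scale_vec \<iota>) U) = \<lfloor>real (CARD('k) * m) / real (h + 1)\<rfloor>"

definition rank_defect :: "('q::field \<Rightarrow> 'f::field) \<Rightarrow> nat \<Rightarrow> ('f ^ 'n) set \<Rightarrow> int" where
  "rank_defect \<iota> m D =
     int m - \<lceil>real (vec.dim D * m) / real CARD('n)\<rceil> - int (min_rank_distance \<iota> D) + 1"

definition quasi_MRD :: "('q::field \<Rightarrow> 'f::field) \<Rightarrow> nat \<Rightarrow> ('f ^ 'n) set \<Rightarrow> bool" where
  "quasi_MRD \<iota> m D \<longleftrightarrow> rank_defect \<iota> m D = 0"

end

theory Submission
  imports Defs
begin

text \<open>
  The numerical hypotheses say that \<open>\<lfloor>k m / n\<rfloor> = h + 1\<close>, so the dual code is quasi-MRD iff its minimum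
  distance is \<open>h + 2\<close>. If the columns of \<open>G\<close> are an \<open>F_q\<close>-basis of \<open>U\<close>, then up to the rank-preserving
  action of \<open>A\<close> the dual code is the kernel of \<open>G\<close>. Expanding a vector \<open>x\<close> of this kernel along an
  \<open>F_q\<close>-basis of the span of its entries turns \<open>G x = 0\<close> into an \<open>F_(q^m)\<close>-linear relation between at
  most \<open>rank_weight x\<close> many \<open>F_q\<close>-independent vectors of \<open>U\<close>, and conversely; such a relation between at
  most \<open>h + 1\<close> vectors is exactly what violates \<open>h\<close>-scatteredness. Hence \<open>U\<close> is \<open>h\<close>-scattered iff the
  distance is at least \<open>h + 2\<close>. It is at most \<open>h + 2\<close> by pigeonhole: vectors with entries in an
  \<open>(h + 2)\<close>-dimensional \<open>F_q\<close>-subspace of \<open>F_(q^m)\<close> number \<open>q ^ ((h + 2) n) > q ^ (k m)\<close>, so two of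
  them have the same image under \<open>G\<close>.
\<close>

section \<open>The embedding of F_q on scalars, vectors and matrices\<close>

definition embed_vec :: "('q \<Rightarrow> 'f) \<Rightarrow> 'q ^ 'n \<Rightarrow> 'f ^ 'n" where
  "embed_vec \<iota> a = (\<chi> j. \<iota> (a $ j))"

lemma embed_vec_nth [simp]: "embed_vec \<iota> a $ j = \<iota> (a $ j)"
  by (simp add: embed_vec_def)

context
  fixes \<iota> :: "'q::field \<Rightarrow> 'f::field"
  assumes emb: "field_embedding \<iota>"
begin

lemma
  shows embedding_1: "\<iota> 1 = 1"
    and embedding_add: "\<iota> (a + b) = \<iota> a + \<iota> b"
    and embedding_mult: "\<iota> (a * b) = \<iota> a * \<iota> b"
  using emb by (auto simp: field_embedding_def)

lemma embedding_0: "\<iota> 0 = 0"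
  using embedding_add[of 0 0] by (metis add.right_neutral add_left_cancel)

lemma embedding_diff: "\<iota> (a - b) = \<iota> a - \<iota> b"
  using embedding_add[of "a - b" b] by (simp add: algebra_simps)

lemma embedding_sum: "\<iota> (\<Sum>i\<in>I. g i) = (\<Sum>i\<in>I. \<iota> (g i))"
  by (induction I rule: infinite_finite_induct) (simp_all add: embedding_0 embedding_add)

lemma embed_vec_sum: "embed_vec \<iota> (\<Sum>i\<in>I. u i *s a i) = (\<Sum>i\<in>I. \<iota> (u i) *s embed_vec \<iota> (a i))"
  by (simp add: vec_eq_iff embedding_sum embedding_mult)

lemma embed_vec_diff: "embed_vec \<iota> (a - b) = embed_vec \<iota> a - embed_vec \<iota> b"
  by (simp add: vec_eq_iff embedding_diff)

lemma map_matrix_mult_embed_vec: "map_matrix \<iota> A *v embed_vec \<iota> a = embed_vec \<iota> (A *v a)"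
  by (simp add: vec_eq_iff matrix_vector_mult_def embedding_sum embedding_mult map_matrix_def)

lemma map_matrix_mult: "map_matrix \<iota> (A ** B) = map_matrix \<iota> A ** map_matrix \<iota> B"
  by (simp add: vec_eq_iff matrix_matrix_mult_def embedding_sum embedding_mult map_matrix_def)

lemma map_matrix_mat_1: "map_matrix \<iota> (mat 1) = mat 1"
  by (simp add: vec_eq_iff mat_def embedding_0 embedding_1 map_matrix_def)

text \<open>As \<open>{c}\<close> is F_q-independent, prescribing the value 1 at \<open>c\<close>
  extends to an F_q-linear map. It serves to bring a relation over F_(q^m) down to F_q while keeping
  the coefficient \<open>c\<close> nonzero.\<close>

lemma exists_functional:
  assumes "c \<noteq> 0"
  obtains g :: "'f \<Rightarrow> 'q" where "\<And>x y. g (x + y) = g x + g y"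
    "\<And>a x. g (\<iota> a * x) = a * g x" "g c = 1"
proof -
  interpret E: vector_space "scale_elem \<iota>"
    by (rule vector_space_scale_elem[OF emb])
  interpret P: vector_space_pair "scale_elem \<iota>" "(*) :: 'q \<Rightarrow> 'q \<Rightarrow> 'q"
    by unfold_locales
  have "E.independent {c}"
    using assms by simp
  from P.linear_independent_extend[OF this, of "\<lambda>_. 1"]
  obtain g where "Vector_Spaces.linear (scale_elem \<iota>) (*) g" "g c = 1"
    by auto
  then show thesis
    using that[of g] by (auto simp: P.linear_add P.linear_scale simp flip: scale_elem_def)
qed

section \<open>Rank weight as the length of an expansion along F_q-vectors\<close>

text \<open>Every entry of \<open>x\<close> is an F_q-combination of the scalars
  \<open>l b\<close>.\<close>

lemma rank_weight_le:
  assumes "finite B" and "x = (\<Sum>b\<in>B. l b *s embed_vec \<iota> (a b))"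
  shows "rank_weight \<iota> x \<le> card B"
proof -
  interpret E: vector_space "scale_elem \<iota>"
    by (rule vector_space_scale_elem[OF emb])
  have "x $ j = (\<Sum>b\<in>B. scale_elem \<iota> (a b $ j) (l b))" for j
    using assms(2) by (simp add: scale_elem_def mult.commute)
  then have "range (($) x) \<subseteq> E.span (l ` B)"
    by (auto intro!: E.span_sum E.span_scale intro: E.span_base)
  then have "E.dim (range (($) x)) \<le> card (l ` B)"
    using assms(1) by (intro E.dim_le_card) auto
  also have "\<dots> \<le> card B"
    using assms(1) by (rule card_image_le)
  finally show ?thesis
    by (simp add: rank_weight_def)
qed

text \<open>\<open>B\<close> is an F_q-basis of the span of the entries; the coordinates of the
  \<open>j\<close>-th entry become the \<open>j\<close>-th components of the vectors
  \<open>a b\<close>.\<close>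

lemma rank_weight_decomposition:
  fixes x :: "'f ^ 'n"
  obtains B a where "finite B" "card B = rank_weight \<iota> x"
    "x = (\<Sum>b\<in>B. b *s embed_vec \<iota> (a b))"
proof -
  interpret E: vector_space "scale_elem \<iota>"
    by (rule vector_space_scale_elem[OF emb])
  obtain B where B: "B \<subseteq> range (($) x)" "E.independent B" "range (($) x) \<subseteq> E.span B"
    "card B = E.dim (range (($) x))"
    by (rule E.basis_exists)
  have "finite B"
    using B(1) by (rule finite_subset) simp
  have "\<exists>u. x $ j = (\<Sum>b\<in>B. scale_elem \<iota> (u b) b)" for j
    using B(3) E.span_finite[OF \<open>finite B\<close>] by blast
  then obtain u where "\<And>j. x $ j = (\<Sum>b\<in>B. scale_elem \<iota> (u j b) b)"
    by metis
  then have "x = (\<Sum>b\<in>B. b *s embed_vec \<iota> (\<chi> j. u j b))"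
    by (simp add: vec_eq_iff scale_elem_def mult.commute)
  with \<open>finite B\<close> B(4) show thesis
    by (intro that) (simp_all add: rank_weight_def)
qed

text \<open>A matrix over F_q acts on the F_q-vectors of an expansion and leaves its coefficients
  alone, so the length does not grow.\<close>

lemma rank_weight_map_matrix_le: "rank_weight \<iota> (map_matrix \<iota> A *v x) \<le> rank_weight \<iota> x"
proof -
  obtain B a where B: "finite B" "card B = rank_weight \<iota> x"
    "x = (\<Sum>b\<in>B. b *s embed_vec \<iota> (a b))"
    by (rule rank_weight_decomposition)
  have "map_matrix \<iota> A *v x = (\<Sum>b\<in>B. b *s embed_vec \<iota> (A *v a b))"
    by (subst B(3)) (simp add: vec.linear_sum vec.linear_scale map_matrix_mult_embed_vec vec.sum vec.scale)
  from rank_weight_le[OF B(1) this] B(2) show ?thesis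
    by simp
qed

section \<open>Kernel vectors of \<open>G\<close> and F_q-independent subsets of
  \<open>U\<close>\<close>

lemma columns_form_basis_bij:
  fixes G :: "'f ^ 'n ^ 'k"
  assumes "columns_form_basis \<iota> G U"
  shows "bij_betw (\<lambda>a. G *v embed_vec \<iota> a) UNIV U"
proof -
  interpret V: vector_space "scale_vec \<iota> :: _ \<Rightarrow> 'f ^ 'k \<Rightarrow> _"
    by (rule vector_space_scale_vec[OF emb])
  from assms have inj: "inj (\<lambda>j. column j G)" and indep: "V.independent (columns G)"
    and span: "V.span (columns G) = U"
    by (auto simp: columns_form_basis_def)
  have columns: "columns G = range (\<lambda>j. column j G)"
    by (auto simp: columns_def)
  \<comment> \<open>The columns are distinct, so the sum over indices becomes a sum over the set of
    columns, the form in which independence and span are stated.\<close>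
  have mult: "G *v embed_vec \<iota> a = (\<Sum>v\<in>columns G. scale_vec \<iota> (a $ inv (\<lambda>j. column j G) v) v)" for a
    unfolding matrix_mult_sum columns by (simp add: sum.reindex[OF inj] scale_vec_def inv_f_f[OF inj])
  show ?thesis
    unfolding bij_betw_def
  proof
    show "inj (\<lambda>a. G *v embed_vec \<iota> a)"
    proof (rule injI)
      fix a b assume "G *v embed_vec \<iota> a = G *v embed_vec \<iota> b"
      then have *: "(\<Sum>v\<in>columns G. scale_vec \<iota>
          (a $ inv (\<lambda>j. column j G) v - b $ inv (\<lambda>j. column j G) v) v) = 0"
        by (simp add: mult V.scale_left_diff_distrib sum_subtractf)
      have "a $ j - b $ j = 0" for j
        using V.independentD[OF indep _ subset_refl *, of "column j G"]
        by (simp add: columns inv_f_f[OF inj])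
      then show "a = b"
        by (simp add: vec_eq_iff)
    qed
    have "u \<in> range (\<lambda>a. G *v embed_vec \<iota> a)" if "u \<in> U" for u
    proof -
      from that obtain w where "u = (\<Sum>v\<in>columns G. scale_vec \<iota> (w v) v)"
        unfolding span[symmetric] by (auto simp: V.span_finite columns)
      then have "u = G *v embed_vec \<iota> (\<chi> j. w (column j G))"
        unfolding mult by (auto simp: columns inv_f_f[OF inj] intro!: sum.cong)
      then show ?thesis
        by blast
    qed
    moreover have "G *v embed_vec \<iota> a \<in> U" for a
      unfolding mult span[symmetric] by (intro V.span_sum V.span_scale V.span_base)
    ultimately show "range (\<lambda>a. G *v embed_vec \<iota> a) = U"
      by blast
  qed
qed

text \<open>The F_q-isomorphism \<open>\<phi>\<close> from F_q^n onto \<open>U\<close> turns an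
  expansion of \<open>x\<close> along independent F_q-vectors into a combination of F_q-independent
  elements of \<open>U\<close> with the same coefficients.\<close>

lemma low_weight_kernel_iff:
  fixes G :: "'f ^ 'n ^ 'k"
  assumes "columns_form_basis \<iota> G U"
  shows "(\<exists>x. x \<noteq> 0 \<and> G *v x = 0 \<and> rank_weight \<iota> x \<le> r) \<longleftrightarrow>
    (\<exists>T\<subseteq>U. finite T \<and> card T \<le> r \<and> \<not> module.dependent (scale_vec \<iota>) T \<and> vec.dependent T)"
    (is "?L \<longleftrightarrow> ?R")
proof -
  interpret V: vector_space "scale_vec \<iota> :: _ \<Rightarrow> 'f ^ 'k \<Rightarrow> _"
    by (rule vector_space_scale_vec[OF emb])
  define \<phi> where "\<phi> a = G *v embed_vec \<iota> a" for a
  have \<phi>: "inj \<phi>" "range \<phi> = U"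
    using columns_form_basis_bij[OF assms] by (auto simp: bij_betw_def \<phi>_def[abs_def])
  have \<phi>_sum: "\<phi> (\<Sum>i\<in>I. u i *s a i) = (\<Sum>i\<in>I. scale_vec \<iota> (u i) (\<phi> (a i)))" for I :: "('q ^ 'n) set" and u a
    by (simp add: \<phi>_def embed_vec_sum vec.sum vec.scale scale_vec_def)
  show ?thesis
  proof
    assume ?L
    then obtain x where x: "x \<noteq> 0" "G *v x = 0" "rank_weight \<iota> x \<le> r"
      by blast
    obtain B a where B: "finite B" "card B = rank_weight \<iota> x"
      "x = (\<Sum>b\<in>B. b *s embed_vec \<iota> (a b))"
      by (rule rank_weight_decomposition)
    \<comment> \<open>The vectors \<open>a b\<close> may coincide or be dependent over F_q.
      Rewriting \<open>x\<close> along a basis \<open>A\<close> of their span makes the images under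
      \<open>\<phi>\<close> independent without lengthening the expansion.\<close>
    obtain A where A: "A \<subseteq> a ` B" "vec.independent A" "a ` B \<subseteq> vec.span A"
      by (rule vec.basis_exists)
    have finA: "finite A"
      using A(1) B(1) finite_surj by blast
    have "\<exists>u. a b = (\<Sum>v\<in>A. u v *s v)" if "b \<in> B" for b
      using A(3) that vec.span_finite[OF finA] by blast
    then obtain u where u: "\<And>b. b \<in> B \<Longrightarrow> a b = (\<Sum>v\<in>A. u b v *s v)"
      by metis
    define \<mu> where "\<mu> v = (\<Sum>b\<in>B. b * \<iota> (u b v))" for v
    have "x = (\<Sum>b\<in>B. b *s (\<Sum>v\<in>A. \<iota> (u b v) *s embed_vec \<iota> v))"
      by (subst B(3), rule sum.cong) (simp_all add: u embed_vec_sum)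
    also have "\<dots> = (\<Sum>v\<in>A. \<Sum>b\<in>B. (b * \<iota> (u b v)) *s embed_vec \<iota> v)"
      by (subst sum.swap) (simp add: vec.scale_sum_right)
    finally have x_eq: "x = (\<Sum>v\<in>A. \<mu> v *s embed_vec \<iota> v)"
      by (simp add: \<mu>_def vec.scale_sum_left)
    have "\<exists>v\<in>A. \<mu> v \<noteq> 0"
      using x(1) x_eq by (metis (no_types, lifting) sum.neutral vec.scale_zero_left)
    moreover have "(\<Sum>v\<in>A. \<mu> v *s \<phi> v) = 0"
      using x(2) unfolding x_eq by (simp add: \<phi>_def vec.sum vec.scale)
    ultimately have dep: "vec.dependent (\<phi> ` A)"
      unfolding vec.dependent_finite[OF finite_imageI[OF finA]]
      by (intro exI[of _ "\<lambda>t. \<mu> (inv \<phi> t)"])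
        (simp add: sum.reindex[OF inj_on_subset[OF \<phi>(1) subset_UNIV]] inv_f_f[OF \<phi>(1)])
    have "V.independent (\<phi> ` A)"
    proof
      assume "V.dependent (\<phi> ` A)"
      then obtain w where w: "\<exists>t\<in>\<phi> ` A. w t \<noteq> 0" "(\<Sum>t\<in>\<phi> ` A. scale_vec \<iota> (w t) t) = 0"
        by (auto simp: V.dependent_finite finA)
      \<comment> \<open>An F_q-relation among the images is the image of one in \<open>A\<close>,
        and \<open>\<phi>\<close> is injective.\<close>
      have "\<phi> (\<Sum>v\<in>A. w (\<phi> v) *s v) = \<phi> 0"
        using w(2) by (simp add: \<phi>_sum sum.reindex[OF inj_on_subset[OF \<phi>(1) subset_UNIV]])
          (simp add: \<phi>_def embed_vec_def embedding_0 flip: zero_vec_def)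
      then have "(\<Sum>v\<in>A. w (\<phi> v) *s v) = 0"
        using \<phi>(1) by (simp add: inj_eq)
      with w(1) A(2) show False
        by (auto simp: vec.dependent_finite[OF finA])
    qed
    moreover have "card (\<phi> ` A) \<le> r"
      using card_image_le[OF finA, of \<phi>] card_mono[OF _ A(1)] card_image_le[OF B(1), of a] B x(3)
      by simp
    ultimately show ?R
      using dep finA \<phi>(2) by (intro exI[of _ "\<phi> ` A"]) auto
  next
    assume ?R
    then obtain T where T: "T \<subseteq> U" "finite T" "card T \<le> r" "V.independent T" "vec.dependent T"
      by blast
    obtain \<mu> t0 where \<mu>: "t0 \<in> T" "\<mu> t0 \<noteq> 0" "(\<Sum>t\<in>T. \<mu> t *s t) = 0"
      using T(2,5) by (auto simp: vec.dependent_finite)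
    define a where "a = inv \<phi>"
    have a: "\<phi> (a t) = t" if "t \<in> T" for t
      using that T(1) \<phi>(2) by (auto simp: a_def f_inv_into_f)
    define x where "x = (\<Sum>t\<in>T. \<mu> t *s embed_vec \<iota> (a t))"
    have "G *v x = (\<Sum>t\<in>T. \<mu> t *s \<phi> (a t))"
      by (simp add: x_def \<phi>_def vec.sum vec.scale)
    then have "G *v x = 0"
      using \<mu>(3) by (simp add: a)
    \<comment> \<open>Applying an \<open>F_q\<close>-linear functional to the entries of \<open>x\<close> descends the relation to \<open>F_q\<close>.\<close>
    moreover have "x \<noteq> 0"
    proof
      assume "x = 0"
      obtain g where g: "\<And>x y. g (x + y) = g x + g y" "\<And>a x. g (\<iota> a * x) = a * g x" "g (\<mu> t0) = (1 :: 'q)"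
        using exists_functional[OF \<mu>(2)] by blast
      have g0: "g 0 = 0"
        using g(1)[of 0 0] by (metis add.right_neutral add_left_cancel)
      have g_sum: "g (sum f I) = (\<Sum>i\<in>I. g (f i))" for f and I :: "('f ^ 'k) set"
        by (induction I rule: infinite_finite_induct) (simp_all add: g0 g(1))
      \<comment> \<open>The components of \<open>a t\<close> lie in F_q, so \<open>g\<close> passes
        through them and acts only on the coefficients \<open>\<mu> t\<close>.\<close>
      have "(\<Sum>t\<in>T. g (\<mu> t) *s a t) $ j = g (x $ j)" for j
        by (simp add: x_def g_sum g(2) mult.commute[of "\<mu> _"]) (simp add: mult.commute)
      then have "(\<Sum>t\<in>T. g (\<mu> t) *s a t) = 0"
        using \<open>x = 0\<close> g0 by (simp add: vec_eq_iff)
      have "embed_vec \<iota> (\<Sum>t\<in>T. g (\<mu> t) *s a t) = 0"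
        using \<open>(\<Sum>t\<in>T. g (\<mu> t) *s a t) = 0\<close> by (simp add: vec_eq_iff embedding_0)
      moreover have "(\<Sum>t\<in>T. \<iota> (g (\<mu> t)) *s \<phi> (a t)) =
          G *v embed_vec \<iota> (\<Sum>t\<in>T. g (\<mu> t) *s a t)"
        by (simp add: \<phi>_def embed_vec_sum vec.sum vec.scale)
      ultimately have "(\<Sum>t\<in>T. \<iota> (g (\<mu> t)) *s \<phi> (a t)) = 0"
        by simp
      then have "(\<Sum>t\<in>T. scale_vec \<iota> (g (\<mu> t)) t) = 0"
        by (simp add: a scale_vec_def)
      from V.independentD[OF T(4) T(2) subset_refl this \<mu>(1)] g(3) show False
        by simp
    qed
    moreover have "rank_weight \<iota> x \<le> r"
      using rank_weight_le[OF T(2) x_def] T(3) by simp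
    ultimately show ?L
      by blast
  qed
qed

end

section \<open>Dimension and membership for the dual code\<close>

text \<open>Rank-nullity: a basis \<open>B\<close> of the kernel is completed to a basis
  \<open>E\<close>, and \<open>N\<close> maps the span of the complement \<open>D\<close>
  isomorphically onto the target.\<close>

lemma dim_kernel_of_surjective:
  fixes N :: "'f::field ^ 'n ^ 'k"
  assumes "surj ((*v) N)"
  shows "vec.dim {x. N *v x = 0} + CARD('k) = CARD('n)"
proof -
  let ?K = "{x. N *v x = 0}"
  obtain B where B: "B \<subseteq> ?K" "vec.independent B" "?K \<subseteq> vec.span B" "card B = vec.dim ?K"
    by (rule vec.basis_exists)
  obtain E where E: "B \<subseteq> E" "vec.independent E" "UNIV \<subseteq> vec.span E"
    by (rule vec.maximal_independent_subset_extend[OF subset_UNIV B(2)])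
  have finE: "finite E"
    by (rule vec.finiteI_independent[OF E(2)])
  define D where "D = E - B"
  have D: "vec.independent D"
    using E(2) by (rule vec.independent_mono) (auto simp: D_def)
  \<comment> \<open>Such an \<open>x\<close> lies in the spans of both \<open>B\<close> and
    \<open>D\<close>; its representation along \<open>E\<close> is supported on two disjoint sets,
    hence is zero.\<close>
  have zero: "x = 0" if "x \<in> vec.span D" "N *v x = 0" for x
  proof -
    have "x \<in> vec.span B"
      using that(2) B(3) by auto
    then have "vec.representation E x = vec.representation B x"
      by (rule vec.representation_extend[OF E(2) _ E(1)])
    moreover have "vec.representation E x = vec.representation D x"
      by (rule vec.representation_extend[OF E(2) that(1)]) (auto simp: D_def)
    ultimately have "{b. vec.representation E x b \<noteq> 0} = {}"
      using vec.representation_ne_zero[of B x] vec.representation_ne_zero[of D x] by (auto simp: D_def)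
    moreover have "x = (\<Sum>b | vec.representation E x b \<noteq> 0. vec.representation E x b *s b)"
      using E(3) by (intro vec.sum_nonzero_representation_eq[OF E(2), symmetric]) blast
    ultimately show ?thesis
      by simp
  qed
  have inj: "inj_on ((*v) N) (vec.span D)"
  proof (rule inj_onI)
    fix x y assume "x \<in> vec.span D" "y \<in> vec.span D" "N *v x = N *v y"
    then show "x = y"
      using zero[of "x - y"] by (simp add: vec.span_diff vec.diff)
  qed
  have "y \<in> vec.span ((*v) N ` D)" for y
  proof -
    obtain x where x: "y = N *v x"
      using assms by (metis surjD)
    have "x \<in> vec.span (B \<union> D)"
      using E(1,3) by (auto simp: D_def Un_absorb1)
    then obtain b d where "b \<in> vec.span B" "d \<in> vec.span D" "x = b + d"
      by (auto simp: vec.span_Un)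
    moreover have "vec.span B \<subseteq> ?K"
      using B(1) by (rule vec.span_minimal) (auto simp: vec.subspace_def vec.add vec.scale)
    ultimately have "y = N *v d"
      using x by (auto simp: vec.add)
    then show ?thesis
      using \<open>d \<in> vec.span D\<close> by (simp add: vec.linear_span_image vec.span_image)
  qed
  then have "vec.span ((*v) N ` D) = UNIV"
    by blast
  then have "vec.dim ((*v) N ` D) = CARD('k)"
    by (metis vec.dim_span vec_dim_card)
  then have "card D = CARD('k)"
    using vec.dim_image_eq[OF _ inj] vec.dim_eq_card_independent[OF D] matrix_vector_mul_linear_gen
    by metis
  moreover have "card E = CARD('n)"
    using vec.basis_card_eq_dim[OF subset_UNIV E(3,2)] unfolding vec_dim_card .
  moreover have "card E = card B + card D"
    using card_Diff_subset[OF _ E(1)] card_mono[OF finE E(1)] finite_subset[OF E(1) finE] by (simp add: D_def)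
  ultimately show ?thesis
    using B(4) by simp
qed

lemma scalar_product_vector_matrix_mult:
  fixes v :: "'f::field ^ 'm"
  shows "scalar_product (v v* M) x = scalar_product v (M *v x)"
  unfolding scalar_product_def vector_matrix_mult_def matrix_vector_mult_def
  by (simp add: sum_distrib_left sum_distrib_right mult_ac) (rule sum.swap)

text \<open>The matrix \<open>M\<close> moves to the other side of the scalar product, and
  orthogonality to a row space need only be tested on the rows.\<close>

lemma mem_dual_code_row_space:
  fixes G :: "'f::field ^ 'n ^ 'k"
  shows "x \<in> dual_code ((\<lambda>v. v v* M) ` vec.span (rows G)) \<longleftrightarrow> G *v (M *v x) = 0"
proof -
  let ?y = "M *v x"
  have "x \<in> dual_code ((\<lambda>v. v v* M) ` vec.span (rows G)) \<longleftrightarrow>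
      (\<forall>v\<in>vec.span (rows G). scalar_product v ?y = 0)"
    by (simp add: dual_code_def scalar_product_vector_matrix_mult)
  also have "\<dots> \<longleftrightarrow> (\<forall>v\<in>rows G. scalar_product v ?y = 0)"
  proof
    assume *: "\<forall>v\<in>rows G. scalar_product v ?y = 0"
    have "vec.span (rows G) \<subseteq> {v. scalar_product v ?y = 0}"
      using * by (intro vec.span_minimal)
        (auto simp: vec.subspace_def scalar_product_def algebra_simps sum.distrib simp flip: sum_distrib_left)
    then show "\<forall>v\<in>vec.span (rows G). scalar_product v ?y = 0"
      by blast
  qed (simp add: vec.span_base)
  also have "\<dots> \<longleftrightarrow> G *v ?y = 0"
    by (auto simp: rows_def row_def scalar_product_def matrix_vector_mult_def vec_eq_iff)
  finally show ?thesis .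
qed

section \<open>Violations of scatteredness as dependent subsets\<close>

text \<open>An \<open>h\<close>-dimensional \<open>W\<close> has no \<open>h + 1\<close> independent
  vectors over the large field, so any \<open>h + 1\<close> F_q-independent vectors of
  \<open>U\<close> in \<open>W\<close> are dependent there. Conversely, \<open>h + 1\<close> vectors
  dependent over the large field fit into some such \<open>W\<close>.\<close>

lemma not_scattered_iff:
  fixes \<iota> :: "'q::field \<Rightarrow> 'f::{field,finite}" and U :: "('f ^ 'k) set"
  assumes emb: "field_embedding \<iota>"
    and "h < CARD('k)" and "h < vector_space.dim (scale_vec \<iota>) U"
  shows "\<not> scattered \<iota> h U \<longleftrightarrow>
    (\<exists>T\<subseteq>U. finite T \<and> card T \<le> h + 1 \<and> \<not> module.dependent (scale_vec \<iota>) T \<and> vec.dependent T)"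
    (is "?L \<longleftrightarrow> ?R")
proof -
  interpret V: vector_space "scale_vec \<iota> :: _ \<Rightarrow> 'f ^ 'k \<Rightarrow> _"
    by (rule vector_space_scale_vec[OF emb])
  show ?thesis
  proof
    assume ?L
    then obtain W where W: "vec.dim W = h" "h < V.dim (U \<inter> W)"
      by (auto simp: scattered_def not_le)
    obtain B where B: "B \<subseteq> U \<inter> W" "V.independent B" "U \<inter> W \<subseteq> V.span B"
      "card B = V.dim (U \<inter> W)"
      by (rule V.basis_exists)
    then obtain T where T: "T \<subseteq> B" "card T = h + 1"
      using W(2) obtain_subset_with_card_n[of "h + 1" B] by auto
    have "vec.dependent T"
    proof (rule ccontr)
      assume "vec.independent T"
      then have "card T \<le> vec.dim W"
        using T(1) B(1) by (intro vec.independent_card_le_dim) auto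
      then show False
        using T(2) W(1) by simp
    qed
    then show ?R
      using T B V.independent_mono[OF B(2) T(1)] by (intro exI[of _ T]) auto
  next
    assume ?R
    then obtain T where T: "T \<subseteq> U" "card T \<le> h + 1" "V.independent T" "vec.dependent T"
      by blast
    obtain E where E: "T \<subseteq> E" "E \<subseteq> U" "V.independent E" "U \<subseteq> V.span E"
      by (rule V.maximal_independent_subset_extend[OF T(1,3)])
    have "h + 1 \<le> card E"
      using V.basis_card_eq_dim[OF E(2,4,3)] assms(3) by simp
    \<comment> \<open>Padding \<open>T\<close> inside \<open>U\<close> to size \<open>h + 1\<close> keeps it dependent over the large field.\<close>
    then obtain S where S: "T \<subseteq> S" "S \<subseteq> E" "card S = h + 1"
      using exists_subset_between[OF T(2) _ E(1)] by auto
    obtain B where B: "B \<subseteq> S" "vec.independent B" "S \<subseteq> vec.span B"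
      by (rule vec.basis_exists)
    have "vec.dependent S"
      using T(4) S(1) by (rule vec.dependent_mono)
    then have "B \<subset> S"
      using B by blast
    then have "card B \<le> h"
      using psubset_card_mono[of S B] S(3) by simp
    \<comment> \<open>The span of \<open>S\<close> may have dimension below \<open>h\<close>,
      whereas \<open>scattered\<close> tests dimension exactly \<open>h\<close>. So \<open>B\<close>
      is enlarged to \<open>h\<close> elements inside a basis \<open>D\<close> of the whole
      space.\<close>
    moreover obtain D where D: "B \<subseteq> D" "vec.independent D" "UNIV \<subseteq> vec.span D"
      by (rule vec.maximal_independent_subset_extend[OF subset_UNIV B(2)])
    moreover have "h \<le> card D"
      using vec.basis_card_eq_dim[OF subset_UNIV D(3,2)] assms(2) unfolding vec_dim_card by simp
    ultimately obtain R where R: "B \<subseteq> R" "R \<subseteq> D" "card R = h"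
      using exists_subset_between[of B h D] by auto
    define W where "W = vec.span R"
    have W: "vec.subspace W" "vec.dim W = h"
      using R(3) vec.dim_span_eq_card_independent[OF vec.independent_mono[OF D(2) R(2)]]
      by (simp_all add: W_def)
    have "S \<subseteq> U \<inter> W"
      using S(2) E(2) B(3) vec.span_mono[OF R(1)] by (auto simp: W_def)
    then obtain F where F: "S \<subseteq> F" "F \<subseteq> U \<inter> W" "V.independent F" "U \<inter> W \<subseteq> V.span F"
      by (rule V.maximal_independent_subset_extend[OF _ V.independent_mono[OF E(3) S(2)]])
    have "h + 1 \<le> V.dim (U \<inter> W)"
      using card_mono[OF _ F(1)] V.basis_card_eq_dim[OF F(2,4,3)] S(3) by simp
    with W show ?L
      by (auto simp: scattered_def not_le intro!: exI[of _ W])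
  qed
qed

section \<open>The upper bound on the distance by pigeonhole\<close>

lemma exists_low_weight_kernel_vector:
  fixes \<iota> :: "'q::{field,finite} \<Rightarrow> 'f::{field,finite}" and G :: "'f ^ 'n ^ 'k"
  assumes emb: "field_embedding \<iota>" and card_f: "CARD('f) = CARD('q) ^ m"
    and "CARD('k) < CARD('n)" and "CARD('k) * m < r * CARD('n)"
  shows "\<exists>x. x \<noteq> 0 \<and> G *v x = 0 \<and> rank_weight \<iota> x \<le> r"
proof -
  interpret E: vector_space "scale_elem \<iota>"
    by (rule vector_space_scale_elem[OF emb])
  have q: "1 < CARD('q)"
    using card_mono[of UNIV "{0, 1 :: 'q}"] by simp
  have f: "1 < CARD('f)"
    using card_mono[of UNIV "{0, 1 :: 'f}"] by simp
  obtain B where B: "E.independent B" "UNIV \<subseteq> E.span B"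
    using E.basis_exists[of UNIV] by blast
  \<comment> \<open>The scalars in \<open>L\<close> are the allowed coefficients of an expansion;
    the inequality says that there are more choices of F_q-vectors to go with them than values of
    \<open>G\<close>.\<close>
  obtain L where L: "L \<subseteq> B" "card L \<le> r"
    "CARD('f) ^ CARD('k) < CARD('q) ^ (CARD('n) * card L)"
  proof (cases "r \<le> card B")
    case True
    then obtain L where "L \<subseteq> B" "card L = r"
      using obtain_subset_with_card_n by metis
    moreover have "CARD('f) ^ CARD('k) < CARD('q) ^ (CARD('n) * r)"
      unfolding card_f power_mult[symmetric]
      using assms(4) q by (intro power_strict_increasing) (simp_all add: mult.commute)
    ultimately show ?thesis
      by (intro that[of L]) auto
  next
    case False
    \<comment> \<open>Every vector has rank weight at most \<open>card B\<close>, so the whole space can be used.\<close>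
    have "UNIV \<subseteq> (\<lambda>u. \<Sum>b\<in>B. scale_elem \<iota> (u b) b) ` (B \<rightarrow>\<^sub>E UNIV)"
    proof
      fix x
      obtain u where "x = (\<Sum>b\<in>B. scale_elem \<iota> (u b) b)"
        using B(2) by (auto simp: E.span_finite)
      then show "x \<in> (\<lambda>u. \<Sum>b\<in>B. scale_elem \<iota> (u b) b) ` (B \<rightarrow>\<^sub>E UNIV)"
        by (intro image_eqI[of _ _ "restrict u B"]) auto
    qed
    then have "CARD('f) \<le> card (B \<rightarrow>\<^sub>E (UNIV :: 'q set))"
      by (rule surj_card_le[rotated]) (simp add: finite_PiE)
    then have "CARD('f) \<le> CARD('q) ^ card B"
      by (simp add: card_PiE)
    then have "CARD('f) ^ CARD('n) \<le> CARD('q) ^ (CARD('n) * card B)"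
      by (metis power_mono power_mult mult.commute le0)
    moreover have "CARD('f) ^ CARD('k) < CARD('f) ^ CARD('n)"
      using assms(3) f by (rule power_strict_increasing)
    ultimately show ?thesis
      using False by (intro that[of B]) auto
  qed
  define \<psi> :: "('f \<Rightarrow> 'q ^ 'n) \<Rightarrow> 'f ^ 'n" where "\<psi> g = (\<Sum>b\<in>L. b *s embed_vec \<iota> (g b))" for g
  have "card (L \<rightarrow>\<^sub>E (UNIV :: ('q ^ 'n) set)) = CARD('q) ^ (CARD('n) * card L)"
    by (simp add: card_PiE power_mult)
  moreover have "card ((\<lambda>g. G *v \<psi> g) ` (L \<rightarrow>\<^sub>E UNIV)) \<le> CARD('f ^ 'k)"
    by (intro card_mono) auto
  ultimately have "\<not> inj_on (\<lambda>g. G *v \<psi> g) (L \<rightarrow>\<^sub>E UNIV)"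
    using L(3) by (intro pigeonhole) simp
  then obtain g g' where g: "g \<in> L \<rightarrow>\<^sub>E UNIV" "g' \<in> L \<rightarrow>\<^sub>E UNIV" "g \<noteq> g'" "G *v \<psi> g = G *v \<psi> g'"
    by (auto simp: inj_on_def)
  \<comment> \<open>Subtracting the two colliding expansions keeps the coefficients in
    \<open>L\<close>, which bounds the rank weight by \<open>card L\<close>.\<close>
  define x where "x = (\<Sum>b\<in>L. b *s embed_vec \<iota> (g b - g' b))"
  have "x = \<psi> g - \<psi> g'"
    by (simp add: x_def \<psi>_def embed_vec_diff[OF emb] vec.scale_right_diff_distrib sum_subtractf)
  then have "G *v x = 0"
    using g(4) by (simp add: vec.diff)
  moreover have "rank_weight \<iota> x \<le> r"
    using rank_weight_le[OF emb _ x_def] L(2) by simp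
  moreover have "x \<noteq> 0"
  proof
    assume "x = 0"
    \<comment> \<open>Each entry of \<open>x = 0\<close> is an F_q-relation among the independent
      scalars in \<open>L\<close>.\<close>
    have "g b = g' b" if "b \<in> L" for b
    proof -
      have "(g b - g' b) $ j = 0" for j
      proof (rule E.independentD[OF E.independent_mono[OF B(1) L(1)] _ subset_refl _ that])
        have "(\<Sum>b\<in>L. scale_elem \<iota> ((g b - g' b) $ j) b) = x $ j"
          by (simp add: x_def scale_elem_def mult.commute)
        then show "(\<Sum>b\<in>L. scale_elem \<iota> ((g b - g' b) $ j) b) = 0"
          using \<open>x = 0\<close> by simp
      qed simp
      then show ?thesis
        by (simp add: vec_eq_iff)
    qed
    then show False
      using g(1-3) by (metis PiE_ext)
  qed
  ultimately show ?thesis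
    by blast
qed

section \<open>Transfer from the kernel of \<open>G\<close> to the dual code, and the rank
  defect\<close>

theorem theorem6p6:
  fixes \<iota> :: "'q::{field,finite} \<Rightarrow> 'f::{field,finite}"
    and q m k h n :: nat
    and U :: "('f ^ 'k) set"
    and C :: "('f ^ 'n) set"
  assumes "field_embedding \<iota>"
    and "CARD('q) = q" and "CARD('f) = q ^ m"
    and "m \<ge> 1" and "k \<ge> 1" and "h < k"
    and "int n = \<lfloor>real (k * m) / real (h + 1)\<rfloor>"
    and "k < n"
    and "int (k * m) - int (h + 2) * \<lfloor>real (k * m) / real (h + 1)\<rfloor> < 0"
    and "is_system \<iota> n k U"
    and "is_code n k C"
    and "associated_code \<iota> U C"
  shows "quasi_maximum_scattered \<iota> m h U \<longleftrightarrow> quasi_MRD \<iota> m (dual_code C)"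
proof -
  note emb = assms(1)
  have k: "CARD('k) = k" and n: "CARD('n) = n"
    and dimU: "vector_space.dim (scale_vec \<iota>) U = n" and spanU: "vec.span U = UNIV"
    using assms(10,11) by (auto simp: is_system_def is_code_def)
  obtain G :: "'f ^ 'n ^ 'k" and A :: "'q ^ 'n ^ 'n" where G: "columns_form_basis \<iota> G U"
    and A: "invertible A" and C: "C = (\<lambda>v. v v* map_matrix \<iota> A) ` vec.span (rows G)"
    using assms(12) by (auto simp: associated_code_def)
  obtain A' where A': "A ** A' = mat 1" "A' ** A = mat 1"
    using A by (auto simp: invertible_def)
  define M where "M = map_matrix \<iota> A"
  define M' where "M' = map_matrix \<iota> A'"
  have MM': "M *v (M' *v x) = x" "M' *v (M *v x) = x" for x
    using A' by (simp_all add: M_def M'_def matrix_vector_mul_assoc map_matrix_mat_1[OF emb]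
        flip: map_matrix_mult[OF emb])
  have dual: "x \<in> dual_code C \<longleftrightarrow> G *v (M *v x) = 0" for x
    by (simp add: C M_def mem_dual_code_row_space)

  \<comment> \<open>\<open>M\<close> and \<open>M'\<close> are inverse to each other, exchange the
    dual code with the kernel of \<open>G\<close>, and neither raises the rank weight.\<close>
  have low: "(\<exists>x\<in>dual_code C. x \<noteq> 0 \<and> rank_weight \<iota> x \<le> r) \<longleftrightarrow>
      (\<exists>y. y \<noteq> 0 \<and> G *v y = 0 \<and> rank_weight \<iota> y \<le> r)" for r
  proof
    assume "\<exists>x\<in>dual_code C. x \<noteq> 0 \<and> rank_weight \<iota> x \<le> r"
    then obtain x where x: "G *v (M *v x) = 0" "x \<noteq> 0" "rank_weight \<iota> x \<le> r"
      by (auto simp: dual)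
    moreover have "M *v x \<noteq> 0"
      using MM'(2)[of x] x(2) by auto
    moreover have "rank_weight \<iota> (M *v x) \<le> r"
      using rank_weight_map_matrix_le[OF emb, of A x] x(3) by (simp add: M_def)
    ultimately show "\<exists>y. y \<noteq> 0 \<and> G *v y = 0 \<and> rank_weight \<iota> y \<le> r"
      by blast
  next
    assume "\<exists>y. y \<noteq> 0 \<and> G *v y = 0 \<and> rank_weight \<iota> y \<le> r"
    then obtain y where y: "y \<noteq> 0" "G *v y = 0" "rank_weight \<iota> y \<le> r"
      by blast
    have "M' *v y \<in> dual_code C"
      by (simp add: dual MM' y(2))
    moreover have "M' *v y \<noteq> 0"
      using MM'(1)[of y] y(1) by auto
    moreover have "rank_weight \<iota> (M' *v y) \<le> r"
      using rank_weight_map_matrix_le[OF emb, of A' y] y(3) by (simp add: M'_def)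
    ultimately show "\<exists>x\<in>dual_code C. x \<noteq> 0 \<and> rank_weight \<iota> x \<le> r"
      by blast
  qed

  \<comment> \<open>The range of \<open>G\<close> is a subspace containing the spanning set
    \<open>U\<close>, so \<open>G\<close> is surjective. This makes the dimension of the dual code
    \<open>n - k\<close>.\<close>
  have "vec.subspace (range ((*v) G))"
    by (auto simp: vec.subspace_def image_iff simp flip: vec.add vec.scale) (metis vec.zero)
  moreover have "U \<subseteq> range ((*v) G)"
    using columns_form_basis_bij[OF emb G] by (auto simp: bij_betw_def)
  ultimately have surjG: "surj ((*v) G)"
    using vec.span_minimal spanU by (metis top.extremum_unique)
  have "y \<in> range ((*v) (G ** M))" for y
  proof -
    obtain x where "y = G *v x"
      using surjG by (metis surjD)
    then have "y = (G ** M) *v (M' *v x)"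
      by (simp add: MM' flip: matrix_vector_mul_assoc)
    then show ?thesis
      by blast
  qed
  then have "surj ((*v) (G ** M))"
    by blast
  moreover have "dual_code C = {x. (G ** M) *v x = 0}"
    by (auto simp: dual matrix_vector_mul_assoc)
  ultimately have dim_dual: "vec.dim (dual_code C) + k = n"
    using dim_kernel_of_surjective[of "G ** M"] by (simp add: k n)

  have "real n \<le> real (k * m) / real (h + 1)"
    using assms(7) by (metis of_int_floor_le of_int_of_nat_eq)
  then have "real n * real (h + 1) \<le> real (k * m)"
    by (simp add: field_simps)
  then have lo: "n * (h + 1) \<le> k * m"
    by (simp only: of_nat_le_iff flip: of_nat_mult)
  have "int (k * m) < int (h + 2) * int n"
    using assms(9) unfolding assms(7)[symmetric] by simp
  then have hi: "k * m < (h + 2) * n"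
    by (simp only: of_nat_less_iff flip: of_nat_mult)
  have n0: "0 < real n"
    using assms(8) by simp
  \<comment> \<open>With dimension \<open>n - k\<close> the ceiling in the rank defect becomes
    \<open>m\<close> minus the floor of \<open>k m / n\<close>, that is \<open>m - (h + 1)\<close>.
    The defect is therefore \<open>h + 2\<close> minus the distance.\<close>
  have "real (vec.dim (dual_code C) * m) / real n = real m - real (k * m) / real n"
  proof -
    have "real (vec.dim (dual_code C)) = real n - real k"
      using dim_dual by linarith
    then have "real (vec.dim (dual_code C) * m) = real n * real m - real (k * m)"
      by (simp add: left_diff_distrib)
    then show ?thesis
      using n0 by (simp add: diff_divide_distrib)
  qed
  then have "\<lceil>real (vec.dim (dual_code C) * m) / real n\<rceil> = \<lceil>real m - real (k * m) / real n\<rceil>"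
    by simp
  also have "\<dots> = int m - \<lfloor>real (k * m) / real n\<rfloor>"
    by linarith
  also have "\<lfloor>real (k * m) / real n\<rfloor> = int (h + 1)"
  proof -
    have "k * m div n = h + 1"
      using lo hi by (intro div_nat_eqI) (simp_all add: mult.commute)
    then show ?thesis
      by (simp only: floor_divide_of_nat_eq)
  qed
  finally have MRD: "quasi_MRD \<iota> m (dual_code C) \<longleftrightarrow> min_rank_distance \<iota> (dual_code C) = h + 2"
    by (auto simp: quasi_MRD_def rank_defect_def n)

  let ?P = "\<lambda>d. \<exists>c\<in>dual_code C. c \<noteq> 0 \<and> rank_weight \<iota> c = d"
  have "\<exists>y. y \<noteq> 0 \<and> G *v y = 0 \<and> rank_weight \<iota> y \<le> h + 2"
    using assms(2,3,8) hi by (intro exists_low_weight_kernel_vector[OF emb]) (simp_all add: k n)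
  \<comment> \<open>This witness also shows that the set under \<open>LEAST\<close> is
    nonempty.\<close>
  then obtain d where d: "?P d" "d \<le> h + 2"
    using low by blast
  have "(LEAST d. ?P d) = h + 2 \<longleftrightarrow> \<not> (\<exists>d. ?P d \<and> d \<le> h + 1)"
  proof
    assume *: "(LEAST d. ?P d) = h + 2"
    show "\<not> (\<exists>d. ?P d \<and> d \<le> h + 1)"
      using Least_le[of ?P] * by fastforce
  next
    assume *: "\<not> (\<exists>d. ?P d \<and> d \<le> h + 1)"
    then have "d = h + 2"
      using d by (metis Suc_1 add_Suc_right le_SucE)
    then show "(LEAST d. ?P d) = h + 2"
      using d(1) * by (intro Least_equality) (auto simp: not_le)
  qed
  also have "(\<exists>d. ?P d \<and> d \<le> h + 1) \<longleftrightarrow> (\<exists>x\<in>dual_code C. x \<noteq> 0 \<and> rank_weight \<iota> x \<le> h + 1)"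
    by blast
  \<comment> \<open>Both sides reduce to the existence of the same set \<open>T\<close>, with
    \<open>r = h + 1\<close>; the bound \<open>h < n\<close> comes from
    \<open>h < k < n\<close>.\<close>
  also have "\<dots> \<longleftrightarrow> \<not> scattered \<iota> h U"
    using assms(6,8) unfolding low
    by (subst not_scattered_iff[OF emb], simp_all add: k dimU low_weight_kernel_iff[OF emb G])
  finally have "min_rank_distance \<iota> (dual_code C) = h + 2 \<longleftrightarrow> scattered \<iota> h U"
    by (simp add: min_rank_distance_def)
  moreover have "quasi_maximum_scattered \<iota> m h U \<longleftrightarrow> scattered \<iota> h U"
    using assms(7) by (simp add: quasi_maximum_scattered_def dimU k)
  ultimately show ?thesis
    using MRD by simp
qed

end
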